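(* An extension $A\subset E$ of unital associative algebras over a field $k$ has a retraction that is a left (resp. right) $A$-module map if and only if there exists an isomorphism of algebras $E\cong A\ltimes V$, where $A\ltimes V$ is the unified product associated to an algebra extending structure $\Omega(A,V)=(\triangleleft,\triangleright,\leftharpoonup,\rightharpoonup,f,\cdot)$ of $A$ through a vector space $V$ having $\leftharpoonup:A\times V\to A$ (resp. $\triangleright:V\times A\to A$) the trivial map.
   Context: All vector spaces, linear and bilinear maps are over an arbitrary field $k$. "Algebra" means unital associative $k$-algebra; algebra maps preserve units. For an inclusion of algebras $A\subset E$, $E$ is a left and right $A$-module by multiplication in $E$. A retraction is a linear map $p:E\to A$ with $p(a)=a$ for all $a\in A$. A (bi)linear map is trivial if it is identically $0$. An extending datum of $A$ through $V$ is a system $\Omega(A,V)=(\triangleleft,\triangleright,\leftharpoonup,\rightharpoonup,f,\cdot)$ of six bilinear maps $\triangleleft:V\times A\to V$, $\triangleright:V\times A\to A$, $\leftharpoonup:A\times V\to A$, $\rightharpoonup:A\times V\to V$, $f:V\times V\to A$, $\cdot:V\times V\to V$. Let $A\ltimes V$ be the vector space $A\times V$ with multiplication $$(a,x)\bullet(b,y)=\bigl(ab+a\leftharpoonup y+x\triangleright b+f(x,y),\ a\rightharpoonup y+x\triangleleft b+x\cdot y\bigr).$$ If this is associative with unit $(1_A,0_V)$, then $\Omega(A,V)$ is called an algebra extending structure of $A$ through $V$ and $A\ltimes V$ the associated unified product.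
   Formalization: The isomorphism of algebras E ≅ A⋉V is required to stabilize A, i.e. to send each a in A to (a,0); with an arbitrary algebra isomorphism the "if" direction fails, e.g. A = T_2(k) embedded in E = M_2(k) × T_2(k) by a ↦ (a, a_22·1). *)

theory Defs
  imports "HOL-Algebra.QuotRing" "HOL-Algebra.Subrings" "HOL-Algebra.Module"
begin

text \<open>
  Vector spaces are \<open>module\<close> records of which only the additive part and the scalar
  multiplication are relevant; the ring fields \<open>mult\<close> and \<open>one\<close> of the record are
  meaningful only for algebras. All maps are considered on the carriers only.
\<close>

locale vector_space_over = R?: field K + module K V
  for K (structure) and V (structure)

text \<open>The library locale \<open>algebra\<close> assumes commutativity, so it cannot be used here.
  The zero algebra is allowed.\<close>

locale assoc_algebra = vector_space_over K E + M?: ring E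
  for K (structure) and E (structure) +
  assumes smult_mult_left:
      "\<lbrakk>c \<in> carrier K; x \<in> carrier E; y \<in> carrier E\<rbrakk> \<Longrightarrow>
        (c \<odot>\<^bsub>E\<^esub> x) \<otimes>\<^bsub>E\<^esub> y = c \<odot>\<^bsub>E\<^esub> (x \<otimes>\<^bsub>E\<^esub> y)"
    and smult_mult_right:
      "\<lbrakk>c \<in> carrier K; x \<in> carrier E; y \<in> carrier E\<rbrakk> \<Longrightarrow>
        x \<otimes>\<^bsub>E\<^esub> (c \<odot>\<^bsub>E\<^esub> y) = c \<odot>\<^bsub>E\<^esub> (x \<otimes>\<^bsub>E\<^esub> y)"

definition linear_map ::
  "('k, 'c) ring_scheme \<Rightarrow> ('k, 'm, 'd) module_scheme \<Rightarrow> ('k, 'n, 'e) module_scheme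
    \<Rightarrow> ('m \<Rightarrow> 'n) \<Rightarrow> bool" where
  "linear_map K M N f \<longleftrightarrow>
     f \<in> carrier M \<rightarrow> carrier N \<and>
     (\<forall>x\<in>carrier M. \<forall>y\<in>carrier M. f (x \<oplus>\<^bsub>M\<^esub> y) = f x \<oplus>\<^bsub>N\<^esub> f y) \<and>
     (\<forall>c\<in>carrier K. \<forall>x\<in>carrier M. f (c \<odot>\<^bsub>M\<^esub> x) = c \<odot>\<^bsub>N\<^esub> f x)"

definition bilinear_map ::
  "('k, 'c) ring_scheme \<Rightarrow> ('k, 'l, 'd) module_scheme \<Rightarrow> ('k, 'm, 'e) module_scheme
    \<Rightarrow> ('k, 'n, 'f) module_scheme \<Rightarrow> ('l \<Rightarrow> 'm \<Rightarrow> 'n) \<Rightarrow> bool" where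
  "bilinear_map K L M N b \<longleftrightarrow>
     (\<forall>x\<in>carrier L. linear_map K M N (b x)) \<and>
     (\<forall>y\<in>carrier M. linear_map K L N (\<lambda>x. b x y))"

definition trivial_map ::
  "('k, 'l, 'd) module_scheme \<Rightarrow> ('k, 'm, 'e) module_scheme
    \<Rightarrow> ('k, 'n, 'f) module_scheme \<Rightarrow> ('l \<Rightarrow> 'm \<Rightarrow> 'n) \<Rightarrow> bool" where
  "trivial_map L M N b \<longleftrightarrow> (\<forall>x\<in>carrier L. \<forall>y\<in>carrier M. b x y = \<zero>\<^bsub>N\<^esub>)"

text \<open>A unital subalgebra is a subset; as an algebra in its own right it is
  \<open>subalg E A\<close>.\<close>

locale algebra_extension = assoc_algebra K E + A?: subring A E + A?: submodule A K E
  for K (structure) and E (structure) and A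

abbreviation subalg ::
  "('k, 'e, 'd) module_scheme \<Rightarrow> 'e set \<Rightarrow> ('k, 'e, 'd) module_scheme" where
  "subalg E A \<equiv> E\<lparr>carrier := A\<rparr>"

definition retraction ::
  "('k, 'c) ring_scheme \<Rightarrow> ('k, 'e, 'd) module_scheme \<Rightarrow> 'e set \<Rightarrow> ('e \<Rightarrow> 'e) \<Rightarrow> bool" where
  "retraction K E A p \<longleftrightarrow> linear_map K E (subalg E A) p \<and> (\<forall>a\<in>A. p a = a)"

definition left_module_map ::
  "('k, 'e, 'd) module_scheme \<Rightarrow> 'e set \<Rightarrow> ('e \<Rightarrow> 'e) \<Rightarrow> bool" where
  "left_module_map E A p \<longleftrightarrow>
     (\<forall>a\<in>A. \<forall>x\<in>carrier E. p (a \<otimes>\<^bsub>E\<^esub> x) = a \<otimes>\<^bsub>E\<^esub> p x)"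

definition right_module_map ::
  "('k, 'e, 'd) module_scheme \<Rightarrow> 'e set \<Rightarrow> ('e \<Rightarrow> 'e) \<Rightarrow> bool" where
  "right_module_map E A p \<longleftrightarrow>
     (\<forall>a\<in>A. \<forall>x\<in>carrier E. p (x \<otimes>\<^bsub>E\<^esub> a) = p x \<otimes>\<^bsub>E\<^esub> a)"

text \<open>The fields are, in this order, the maps written
  \<open>\<triangleleft>\<close>, \<open>\<triangleright>\<close>, \<open>\<leftharpoonup>\<close>, \<open>\<rightharpoonup>\<close>, \<open>f\<close>, \<open>\<cdot>\<close>.\<close>

record ('a, 'v) ext_datum =
  triL :: "'v \<Rightarrow> 'a \<Rightarrow> 'v"
  triR :: "'v \<Rightarrow> 'a \<Rightarrow> 'a"
  harpL :: "'a \<Rightarrow> 'v \<Rightarrow> 'a"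
  harpR :: "'a \<Rightarrow> 'v \<Rightarrow> 'v"
  cocyc :: "'v \<Rightarrow> 'v \<Rightarrow> 'a"
  vmult :: "'v \<Rightarrow> 'v \<Rightarrow> 'v"

definition extending_datum ::
  "('k, 'c) ring_scheme \<Rightarrow> ('k, 'a, 'd) module_scheme \<Rightarrow> ('k, 'v, 'e) module_scheme
    \<Rightarrow> ('a, 'v) ext_datum \<Rightarrow> bool" where
  "extending_datum K A V \<Omega> \<longleftrightarrow>
     bilinear_map K V A V (triL \<Omega>) \<and>
     bilinear_map K V A A (triR \<Omega>) \<and>
     bilinear_map K A V A (harpL \<Omega>) \<and>
     bilinear_map K A V V (harpR \<Omega>) \<and>
     bilinear_map K V V A (cocyc \<Omega>) \<and>
     bilinear_map K V V V (vmult \<Omega>)"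

definition unified_product ::
  "('k, 'a, 'd) module_scheme \<Rightarrow> ('k, 'v, 'e) module_scheme \<Rightarrow> ('a, 'v) ext_datum
    \<Rightarrow> ('k, 'a \<times> 'v) module" where
  "unified_product A V \<Omega> =
     \<lparr>carrier = carrier A \<times> carrier V,
      mult = (\<lambda>(a, x) (b, y).
        (a \<otimes>\<^bsub>A\<^esub> b \<oplus>\<^bsub>A\<^esub> harpL \<Omega> a y \<oplus>\<^bsub>A\<^esub> triR \<Omega> x b \<oplus>\<^bsub>A\<^esub> cocyc \<Omega> x y,
         harpR \<Omega> a y \<oplus>\<^bsub>V\<^esub> triL \<Omega> x b \<oplus>\<^bsub>V\<^esub> vmult \<Omega> x y)),
      one = (\<one>\<^bsub>A\<^esub>, \<zero>\<^bsub>V\<^esub>),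
      zero = (\<zero>\<^bsub>A\<^esub>, \<zero>\<^bsub>V\<^esub>),
      add = (\<lambda>(a, x) (b, y). (a \<oplus>\<^bsub>A\<^esub> b, x \<oplus>\<^bsub>V\<^esub> y)),
      smult = (\<lambda>c (a, x). (c \<odot>\<^bsub>A\<^esub> a, c \<odot>\<^bsub>V\<^esub> x))\<rparr>"

text \<open>Distributivity and compatibility with scalars follow from bilinearity, so associativity
  and the unit law are all that is required.\<close>

definition algebra_extending_structure ::
  "('k, 'c) ring_scheme \<Rightarrow> ('k, 'a, 'd) module_scheme \<Rightarrow> ('k, 'v, 'e) module_scheme
    \<Rightarrow> ('a, 'v) ext_datum \<Rightarrow> bool" where
  "algebra_extending_structure K A V \<Omega> \<longleftrightarrow>
     extending_datum K A V \<Omega> \<and> monoid (unified_product A V \<Omega>)"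

definition algebra_iso ::
  "('k, 'c) ring_scheme \<Rightarrow> ('k, 'e, 'd) module_scheme \<Rightarrow> ('k, 'f, 'g) module_scheme
    \<Rightarrow> ('e \<Rightarrow> 'f) set" where
  "algebra_iso K E F = {\<phi> \<in> ring_iso E F. linear_map K E F \<phi>}"

text \<open>
  \<open>unified_product_form K E A V \<Omega> \<phi>\<close>: the extension \<open>A \<subseteq> E\<close> is identified by \<open>\<phi>\<close> with the
  unified product of \<open>A\<close> and \<open>V\<close> given by \<open>\<Omega>\<close>. The isomorphism stabilizes \<open>A\<close>, i.e. it
  carries the inclusion of \<open>A\<close> in \<open>E\<close> to the canonical one \<open>a \<mapsto> (a, 0)\<close>. An arbitrary
  isomorphism would not do: for upper triangular \<open>2 \<times> 2\<close> matrices \<open>A\<close> and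
  \<open>E = M\<^sub>2(k) \<times> A\<close>, the embedding \<open>a \<mapsto> (a, a)\<close> has the retraction \<open>snd\<close>, an \<open>A\<close>-bimodule
  map, while \<open>a \<mapsto> (a, a\<^sub>2\<^sub>2 1)\<close> has no left \<open>A\<close>-linear retraction.
\<close>

definition unified_product_form ::
  "('k, 'c) ring_scheme \<Rightarrow> ('k, 'e, 'd) module_scheme \<Rightarrow> 'e set \<Rightarrow> ('k, 'v, 'f) module_scheme
    \<Rightarrow> ('e, 'v) ext_datum \<Rightarrow> ('e \<Rightarrow> 'e \<times> 'v) \<Rightarrow> bool" where
  "unified_product_form K E A V \<Omega> \<phi> \<longleftrightarrow>
     vector_space_over K V \<and>
     algebra_extending_structure K (subalg E A) V \<Omega> \<and>
     \<phi> \<in> algebra_iso K E (unified_product (subalg E A) V \<Omega>) \<and>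
     (\<forall>a\<in>A. \<phi> a = (a, \<zero>\<^bsub>V\<^esub>))"

end

theory Submission
  imports Defs
begin

text \<open>
  A retraction \<open>p\<close> splits \<open>E\<close> as \<open>A \<oplus> ker p\<close>, and transporting the multiplication of \<open>E\<close> along
  \<open>x \<mapsto> (p x, x - p x)\<close> gives a unified product in which \<open>a \<leftharpoonup> x = p (a x)\<close> and
  \<open>x \<triangleright> a = p (x a)\<close>; these vanish on \<open>ker p\<close> when \<open>p\<close> is left, respectively right, \<open>A\<close>-linear.
  Conversely, \<open>fst \<circ> \<phi>\<close> is a retraction, and the defect of its left (right) \<open>A\<close>-linearity is
  exactly \<open>\<leftharpoonup>\<close> (\<open>\<triangleright>\<close>).
\<close>

lemma linear_map_closed:
  "linear_map K M N f \<Longrightarrow> x \<in> carrier M \<Longrightarrow> f x \<in> carrier N"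
  by (auto simp: linear_map_def)

lemma linear_map_add:
  "linear_map K M N f \<Longrightarrow> x \<in> carrier M \<Longrightarrow> y \<in> carrier M \<Longrightarrow>
    f (x \<oplus>\<^bsub>M\<^esub> y) = f x \<oplus>\<^bsub>N\<^esub> f y"
  by (auto simp: linear_map_def)

lemma linear_map_smult:
  "linear_map K M N f \<Longrightarrow> c \<in> carrier K \<Longrightarrow> x \<in> carrier M \<Longrightarrow>
    f (c \<odot>\<^bsub>M\<^esub> x) = c \<odot>\<^bsub>N\<^esub> f x"
  by (auto simp: linear_map_def)

lemma linear_map_zero:
  assumes "abelian_group M" "abelian_group N" "linear_map K M N f"
  shows "f \<zero>\<^bsub>M\<^esub> = \<zero>\<^bsub>N\<^esub>"
proof -
  interpret M: abelian_group M by fact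
  interpret N: abelian_group N by fact
  have "f \<zero>\<^bsub>M\<^esub> \<oplus>\<^bsub>N\<^esub> f \<zero>\<^bsub>M\<^esub> = f \<zero>\<^bsub>M\<^esub>"
    using linear_map_add[OF assms(3) M.zero_closed M.zero_closed] by simp
  moreover have "f \<zero>\<^bsub>M\<^esub> \<in> carrier N"
    using linear_map_closed[OF assms(3)] by simp
  ultimately show ?thesis
    using N.add.l_cancel_one by blast
qed

text \<open>For fixed \<open>x\<close> or fixed \<open>y\<close> the map is linear in the other
  argument. This discards the terms of a product in \<open>unified_product\<close> where a factor of
  the form \<open>(a, 0)\<close> contributes its zero \<open>V\<close>-component.\<close>

lemma bilinear_map_zero:
  assumes "abelian_group L" "abelian_group M" "abelian_group N" "bilinear_map K L M N b"
  shows "x \<in> carrier L \<Longrightarrow> b x \<zero>\<^bsub>M\<^esub> = \<zero>\<^bsub>N\<^esub>"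
    and "y \<in> carrier M \<Longrightarrow> b \<zero>\<^bsub>L\<^esub> y = \<zero>\<^bsub>N\<^esub>"
  using assms(4) linear_map_zero[OF assms(2,3), where K = K]
    linear_map_zero[OF assms(1,3), where K = K and f = "\<lambda>x. b x y"]
  by (auto simp: bilinear_map_def)

text \<open>The kernel of a retraction inherits from \<open>E\<close> a record type with possible
  extra fields. Truncation gives it the plain type \<open>module\<close> that the theorem asks of
  \<open>V\<close>, leaving carrier and operations unchanged.\<close>

lemma module_truncate:
  assumes "module K M"
  shows "module K (module.truncate M)"
proof -
  interpret module K M by fact
  have "abelian_group (module.truncate M)"
    by (rule abelian_groupI) (auto simp: module.defs M.a_ac intro: M.l_neg)
  then show ?thesis
    using R.is_cring
    by (intro moduleI) (auto simp: module.defs smult_l_distr smult_r_distr smult_assoc1)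
qed

context algebra_extension
begin

lemma A_subset: "a \<in> A \<Longrightarrow> a \<in> carrier E"
  using A.subset by auto

lemma subalg_ring: "ring (subalg E A)"
  using M.subring_is_ring A.subring_axioms .

text \<open>Every component of the extending datum of a retraction is a linear map composed with the
  multiplication of \<open>E\<close>.\<close>

lemma bilinear_map_mult:
  assumes h: "linear_map K E N h"
    and L: "carrier L \<subseteq> carrier E" "add L = add E" "smult L = smult E"
    and M': "carrier M' \<subseteq> carrier E" "add M' = add E" "smult M' = smult E"
  shows "bilinear_map K L M' N (\<lambda>x y. h (x \<otimes>\<^bsub>E\<^esub> y))"
  unfolding bilinear_map_def linear_map_def
  using linear_map_closed[OF h] linear_map_add[OF h] linear_map_smult[OF h]
    subsetD[OF L(1)] subsetD[OF M'(1)]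
  by (auto simp: L(2,3) M'(2,3) M.l_distr M.r_distr smult_mult_left smult_mult_right)

text \<open>Addition and scalars of the unified product are componentwise, so \<open>fst\<close> is
  linear, and \<open>fst\<close> of \<open>(a, 0)\<close> is \<open>a\<close>. The first component
  of \<open>(a, 0)\<close> times \<open>(b, y)\<close> is \<open>ab + harpL \<Omega> a y\<close>,
  since \<open>triR \<Omega> 0 b\<close> and \<open>cocyc \<Omega> 0 y\<close> vanish by
  bilinearity.\<close>

lemma unified_product_form_retraction:
  assumes form: "unified_product_form K E A V \<Omega> \<phi>"
  shows "retraction K E A (fst \<circ> \<phi>)"
    and "trivial_map (subalg E A) V (subalg E A) (harpL \<Omega>) \<Longrightarrow> left_module_map E A (fst \<circ> \<phi>)"
    and "trivial_map V (subalg E A) (subalg E A) (triR \<Omega>) \<Longrightarrow> right_module_map E A (fst \<circ> \<phi>)"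
proof -
  let ?A = "subalg E A" and ?U = "unified_product (subalg E A) V \<Omega>"
  interpret V: vector_space_over K V
    using form by (simp add: unified_product_form_def)
  interpret S: ring ?A by (rule subalg_ring)
  have lin: "linear_map K E ?U \<phi>" and hom: "\<phi> \<in> ring_hom E ?U"
    and \<phi>A: "\<And>a. a \<in> A \<Longrightarrow> \<phi> a = (a, \<zero>\<^bsub>V\<^esub>)"
    and datum: "extending_datum K ?A V \<Omega>"
    using form
    by (auto simp: unified_product_form_def algebra_iso_def ring_iso_def
        algebra_extending_structure_def)
  have \<phi>_mem: "\<And>x. x \<in> carrier E \<Longrightarrow> \<phi> x \<in> A \<times> carrier V"
    using linear_map_closed[OF lin] by (simp add: unified_product_def)
  note groups = S.abelian_group_axioms V.M.abelian_group_axioms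
  have fst_add: "fst (u \<oplus>\<^bsub>?U\<^esub> v) = fst u \<oplus>\<^bsub>E\<^esub> fst v" for u v
    by (simp add: unified_product_def split_beta)
  have fst_smult: "fst (c \<odot>\<^bsub>?U\<^esub> u) = c \<odot>\<^bsub>E\<^esub> fst u" for c u
    by (simp add: unified_product_def split_beta)
  show "retraction K E A (fst \<circ> \<phi>)"
    unfolding retraction_def linear_map_def
    using linear_map_add[OF lin] linear_map_smult[OF lin] \<phi>_mem \<phi>A
    by (auto simp: fst_add fst_smult mem_Times_iff)
  \<comment> \<open>Lets simp drop the vanishing summands below; the premise speaks of
    \<open>A\<close> because first components lie there.\<close>
  have [simp]: "x \<oplus>\<^bsub>E\<^esub> \<zero>\<^bsub>E\<^esub> = x" if "x \<in> A" for x
    using that A_subset by simp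
  {
    assume triv: "trivial_map ?A V ?A (harpL \<Omega>)"
    show "left_module_map E A (fst \<circ> \<phi>)"
      unfolding left_module_map_def
    proof (intro ballI)
      fix a x assume a: "a \<in> A" and x: "x \<in> carrier E"
      obtain b y where bx: "\<phi> x = (b, y)" "b \<in> A" "y \<in> carrier V"
        using \<phi>_mem[OF x] by auto
      have "\<phi> (a \<otimes>\<^bsub>E\<^esub> x) = \<phi> a \<otimes>\<^bsub>?U\<^esub> \<phi> x"
        using ring_hom_mult[OF hom] a x A_subset by blast
      moreover have "triR \<Omega> \<zero>\<^bsub>V\<^esub> b = \<zero>\<^bsub>E\<^esub>"
        using bilinear_map_zero(2)[OF groups(2,1,1)] datum bx(2)
        by (force simp: extending_datum_def)
      moreover have "cocyc \<Omega> \<zero>\<^bsub>V\<^esub> y = \<zero>\<^bsub>E\<^esub>"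
        using bilinear_map_zero(2)[OF groups(2,2,1)] datum bx(3)
        by (force simp: extending_datum_def)
      moreover have "harpL \<Omega> a y = \<zero>\<^bsub>E\<^esub>"
        using triv a bx(3) by (simp add: trivial_map_def)
      ultimately show "(fst \<circ> \<phi>) (a \<otimes>\<^bsub>E\<^esub> x) = a \<otimes>\<^bsub>E\<^esub> (fst \<circ> \<phi>) x"
        using a bx by (simp add: \<phi>A unified_product_def)
    qed
  }
  {
    assume triv: "trivial_map V ?A ?A (triR \<Omega>)"
    show "right_module_map E A (fst \<circ> \<phi>)"
      unfolding right_module_map_def
    proof (intro ballI)
      fix a x assume a: "a \<in> A" and x: "x \<in> carrier E"
      obtain b y where bx: "\<phi> x = (b, y)" "b \<in> A" "y \<in> carrier V"
        using \<phi>_mem[OF x] by auto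
      have "\<phi> (x \<otimes>\<^bsub>E\<^esub> a) = \<phi> x \<otimes>\<^bsub>?U\<^esub> \<phi> a"
        using ring_hom_mult[OF hom] a x A_subset by blast
      \<comment> \<open>Mirror image of the left case: \<open>(b, y)\<close> times
        \<open>(a, 0)\<close> has first component \<open>ba + triR \<Omega> y a\<close> once the two
        terms with a zero argument are gone.\<close>
      moreover have "harpL \<Omega> b \<zero>\<^bsub>V\<^esub> = \<zero>\<^bsub>E\<^esub>"
        using bilinear_map_zero(1)[OF groups(1,2,1)] datum bx(2)
        by (force simp: extending_datum_def)
      moreover have "cocyc \<Omega> y \<zero>\<^bsub>V\<^esub> = \<zero>\<^bsub>E\<^esub>"
        using bilinear_map_zero(1)[OF groups(2,2,1)] datum bx(3)
        by (force simp: extending_datum_def)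
      moreover have "triR \<Omega> y a = \<zero>\<^bsub>E\<^esub>"
        using triv a bx(3) by (simp add: trivial_map_def)
      ultimately show "(fst \<circ> \<phi>) (x \<otimes>\<^bsub>E\<^esub> a) = (fst \<circ> \<phi>) x \<otimes>\<^bsub>E\<^esub> a"
        using a bx by (simp add: \<phi>A unified_product_def)
    qed
  }
qed

text \<open>\<open>q\<close> is the projection onto the kernel of \<open>p\<close> along
  \<open>A\<close>, and \<open>V\<close> is that kernel. Each field of \<open>\<Omega>\<close> is
  the \<open>A\<close>-part (via \<open>p\<close>) or the kernel part (via \<open>q\<close>) of a
  product in \<open>E\<close>. If \<open>p\<close> is left linear, then
  \<open>p (a x) = a (p x) = 0\<close> for \<open>x\<close> in the kernel, so
  \<open>harpL \<Omega>\<close> vanishes; \<open>triR \<Omega>\<close> is treated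
  symmetrically.\<close>

lemma retraction_unified_product_form:
  fixes p
  assumes p: "retraction K E A p"
  defines "q \<equiv> \<lambda>x. x \<ominus>\<^bsub>E\<^esub> p x"
  defines "V \<equiv> module.truncate (subalg E {x \<in> carrier E. p x = \<zero>\<^bsub>E\<^esub>})"
  defines "\<Omega> \<equiv> \<lparr>triL = \<lambda>x y. q (x \<otimes>\<^bsub>E\<^esub> y), triR = \<lambda>x y. p (x \<otimes>\<^bsub>E\<^esub> y),
    harpL = \<lambda>x y. p (x \<otimes>\<^bsub>E\<^esub> y), harpR = \<lambda>x y. q (x \<otimes>\<^bsub>E\<^esub> y),
    cocyc = \<lambda>x y. p (x \<otimes>\<^bsub>E\<^esub> y), vmult = \<lambda>x y. q (x \<otimes>\<^bsub>E\<^esub> y)\<rparr>"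
  shows "unified_product_form K E A V \<Omega> (\<lambda>x. (p x, q x))"
    and "left_module_map E A p \<Longrightarrow> trivial_map (subalg E A) V (subalg E A) (harpL \<Omega>)"
    and "right_module_map E A p \<Longrightarrow> trivial_map V (subalg E A) (subalg E A) (triR \<Omega>)"
proof -
  let ?A = "subalg E A" and ?B = "{x \<in> carrier E. p x = \<zero>\<^bsub>E\<^esub>}"
  let ?U = "unified_product ?A V \<Omega>" and ?\<phi> = "\<lambda>x. (p x, q x)"
  have lin: "linear_map K E ?A p" and pA: "\<And>a. a \<in> A \<Longrightarrow> p a = a"
    using p by (auto simp: retraction_def)
  have p_mem: "\<And>x. x \<in> carrier E \<Longrightarrow> p x \<in> A"
    and p_add: "\<And>x y. x \<in> carrier E \<Longrightarrow> y \<in> carrier E \<Longrightarrow> p (x \<oplus>\<^bsub>E\<^esub> y) = p x \<oplus>\<^bsub>E\<^esub> p y"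
    and p_smult: "\<And>c x. c \<in> carrier K \<Longrightarrow> x \<in> carrier E \<Longrightarrow> p (c \<odot>\<^bsub>E\<^esub> x) = c \<odot>\<^bsub>E\<^esub> p x"
    using linear_map_closed[OF lin] linear_map_add[OF lin] linear_map_smult[OF lin] by auto
  have p_E: "\<And>x. x \<in> carrier E \<Longrightarrow> p x \<in> carrier E"
    using p_mem A_subset by blast
  have zeroA: "\<zero>\<^bsub>E\<^esub> \<in> A" and oneA: "\<one>\<^bsub>E\<^esub> \<in> A"
    using ring.ring_simprules(2,6)[OF subalg_ring] by simp_all
  have p_zero: "p \<zero>\<^bsub>E\<^esub> = \<zero>\<^bsub>E\<^esub>"
    by (rule pA[OF zeroA])
  have p_neg: "p (\<ominus>\<^bsub>E\<^esub> x) = \<ominus>\<^bsub>E\<^esub> p x" if "x \<in> carrier E" for x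
    using p_add[of "\<ominus>\<^bsub>E\<^esub> x" x] that p_E p_zero
    by (metis M.add.inv_closed M.l_neg M.minus_equality)
  have q_E: "\<And>x. x \<in> carrier E \<Longrightarrow> q x \<in> carrier E"
    using p_E by (simp add: q_def)
  \<comment> \<open>\<open>p\<close> is idempotent, because \<open>p x\<close> lies in
    \<open>A\<close> and \<open>p\<close> fixes \<open>A\<close>.\<close>
  have p_q: "p (q x) = \<zero>\<^bsub>E\<^esub>" if "x \<in> carrier E" for x
    using that p_E by (simp add: q_def a_minus_def p_add p_neg pA p_mem M.r_neg)
  have decomp: "p x \<oplus>\<^bsub>E\<^esub> q x = x" if "x \<in> carrier E" for x
    using that p_E[OF that] unfolding q_def by algebra
  have q_add: "q (x \<oplus>\<^bsub>E\<^esub> y) = q x \<oplus>\<^bsub>E\<^esub> q y" if "x \<in> carrier E" "y \<in> carrier E" for x y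
    using that p_E[OF that(1)] p_E[OF that(2)] unfolding q_def p_add[OF that] by algebra
  have q_smult: "q (c \<odot>\<^bsub>E\<^esub> x) = c \<odot>\<^bsub>E\<^esub> q x" if "c \<in> carrier K" "x \<in> carrier E" for c x
    using that p_E by (simp add: q_def a_minus_def p_smult smult_r_distr smult_r_minus)
  have q_A: "q a = \<zero>\<^bsub>E\<^esub>" if "a \<in> A" for a
    using that A_subset by (simp add: q_def pA a_minus_def M.r_neg)
  have q_B: "q x = x" if "x \<in> ?B" for x
    using that by (simp add: q_def a_minus_def)
  have V_simps: "carrier V = ?B" "add V = add E" "smult V = smult E" "zero V = zero E"
    by (simp_all add: V_def module.defs)
  have "submodule ?B K E"
    by (rule submoduleI) (auto simp: p_zero p_neg p_add p_smult)
  then have "module K (subalg E ?B)"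
    using submodule.submodule_is_module module_axioms by blast
  then have modV: "module K V"
    unfolding V_def by (rule module_truncate)
  have linq: "linear_map K E V q"
    using q_E p_q q_add q_smult by (auto simp: linear_map_def V_simps)
  have "A \<subseteq> carrier E"
    using A_subset by blast
  then have datum: "extending_datum K ?A V \<Omega>"
    unfolding extending_datum_def \<Omega>_def
    by (auto intro!: bilinear_map_mult lin linq simp: V_simps)
  \<comment> \<open>The inverse is addition in \<open>E\<close>: \<open>p\<close> fixes
    \<open>A\<close> and kills the kernel, while \<open>q\<close> does the opposite.\<close>
  have bij: "bij_betw ?\<phi> (carrier E) (carrier ?U)"
    by (rule bij_betw_byWitness[where f' = "\<lambda>(a, x). a \<oplus>\<^bsub>E\<^esub> x"])
      (auto simp: unified_product_def V_simps decomp p_mem q_E p_q p_add q_add pA q_A q_B A_subset)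
  have mult: "?\<phi> (x \<otimes>\<^bsub>E\<^esub> y) = ?\<phi> x \<otimes>\<^bsub>?U\<^esub> ?\<phi> y" if x: "x \<in> carrier E" and y: "y \<in> carrier E" for x y
  proof -
    note E = p_E[OF x] q_E[OF x] p_E[OF y] q_E[OF y]
    have "x \<otimes>\<^bsub>E\<^esub> y = (p x \<oplus>\<^bsub>E\<^esub> q x) \<otimes>\<^bsub>E\<^esub> (p y \<oplus>\<^bsub>E\<^esub> q y)"
      using x y by (simp add: decomp)
    also have "\<dots> = p x \<otimes>\<^bsub>E\<^esub> p y \<oplus>\<^bsub>E\<^esub> p x \<otimes>\<^bsub>E\<^esub> q y \<oplus>\<^bsub>E\<^esub> q x \<otimes>\<^bsub>E\<^esub> p y \<oplus>\<^bsub>E\<^esub> q x \<otimes>\<^bsub>E\<^esub> q y"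
      using E by (simp add: M.l_distr M.r_distr M.a_assoc M.add.m_lcomm)
    finally have xy: "x \<otimes>\<^bsub>E\<^esub> y = \<dots>" .
    \<comment> \<open>Of the four summands this one lies in the subring, so \<open>p\<close> fixes
      it and \<open>q\<close> kills it. The other three are split by \<open>p\<close> and
      \<open>q\<close> into exactly the six fields of \<open>\<Omega>\<close>.\<close>
    have "p x \<otimes>\<^bsub>E\<^esub> p y \<in> A"
      using ring.ring_simprules(5)[OF subalg_ring] p_mem x y by simp
    then show ?thesis
      unfolding xy using E
      by (simp add: unified_product_def \<Omega>_def V_simps p_add q_add pA q_A q_E)
  qed
  have one: "?\<phi> \<one>\<^bsub>E\<^esub> = \<one>\<^bsub>?U\<^esub>"
    using oneA by (simp add: unified_product_def V_simps pA q_A)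
  have lin\<phi>: "linear_map K E ?U ?\<phi>"
    by (auto simp: linear_map_def unified_product_def V_simps p_mem q_E p_q p_add q_add p_smult q_smult)
  have hom: "?\<phi> \<in> ring_hom E ?U"
    using linear_map_closed[OF lin\<phi>] mult linear_map_add[OF lin\<phi>] one
    by (intro ring_hom_memI) blast+
  \<comment> \<open>The image of a monoid under a multiplicative map is a monoid. As the map is onto
    and sends one to one, this image is all of \<open>?U\<close>, which thus inherits associativity
    and unit from \<open>E\<close>.\<close>
  have "?U\<lparr>carrier := ?\<phi> ` carrier E, one := ?\<phi> \<one>\<^bsub>E\<^esub>\<rparr> = ?U"
    using bij_betw_imp_surj_on[OF bij] one by simp
  then have "monoid ?U"
    using M.hom_imp_img_monoid[of ?\<phi> ?U] linear_map_closed[OF lin\<phi>] mult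
    by (simp add: hom_def)
  then show "unified_product_form K E A V \<Omega> ?\<phi>"
    using modV datum bij hom lin\<phi> pA q_A R.field_axioms
    by (auto simp: unified_product_form_def vector_space_over_def algebra_extending_structure_def
        algebra_iso_def ring_iso_def V_simps)
  show "trivial_map ?A V ?A (harpL \<Omega>)" if "left_module_map E A p"
    using that A_subset by (auto simp: left_module_map_def trivial_map_def \<Omega>_def V_simps)
  show "trivial_map V ?A ?A (triR \<Omega>)" if "right_module_map E A p"
    using that A_subset by (auto simp: right_module_map_def trivial_map_def \<Omega>_def V_simps)
qed

end

text \<open>HOL has no quantifier over types inside a formula, so the equivalences take
  \<open>V\<close> with elements of type \<open>'e\<close>; this suffices because the kernel of
  \<open>p\<close> is a subset of \<open>E\<close>. The last conjunct gives the converse for a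
  \<open>V\<close> over any type \<open>'v\<close>.\<close>

theorem corollary2p4:
  fixes K :: "('k, 'c) ring_scheme"
    and E :: "('k, 'e, 'd) module_scheme"
    and A :: "'e set"
  assumes "algebra_extension K E A"
  shows
    "((\<exists>p. retraction K E A p \<and> left_module_map E A p) \<longleftrightarrow>
        (\<exists>(V :: ('k, 'e) module) \<Omega> \<phi>. unified_product_form K E A V \<Omega> \<phi> \<and>
           trivial_map (subalg E A) V (subalg E A) (harpL \<Omega>))) \<and>
     ((\<exists>p. retraction K E A p \<and> right_module_map E A p) \<longleftrightarrow>
        (\<exists>(V :: ('k, 'e) module) \<Omega> \<phi>. unified_product_form K E A V \<Omega> \<phi> \<and>
           trivial_map V (subalg E A) (subalg E A) (triR \<Omega>))) \<and>
     (\<forall>(V :: ('k, 'v, 'f) module_scheme) \<Omega> \<phi>. unified_product_form K E A V \<Omega> \<phi> \<longrightarrow>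
        (trivial_map (subalg E A) V (subalg E A) (harpL \<Omega>) \<longrightarrow>
           (\<exists>p. retraction K E A p \<and> left_module_map E A p)) \<and>
        (trivial_map V (subalg E A) (subalg E A) (triR \<Omega>) \<longrightarrow>
           (\<exists>p. retraction K E A p \<and> right_module_map E A p)))"
proof -
  interpret algebra_extension K E A by fact
  show ?thesis
    \<comment> \<open>Six implications remain: two construct \<open>V\<close> from the kernel of
      \<open>p\<close>, four take \<open>fst \<circ> \<phi>\<close> as the retraction.\<close>
    by (intro conjI iffI allI impI; (elim exE conjE)?)
      (fast intro: retraction_unified_product_form unified_product_form_retraction)+
qed

end
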